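(* Let $X\in\mathbb{R}^{p_1\times\cdots\times p_K}$ be an observed data array, let $p=\prod_{k=1}^K p_k$, let $\{1,\ldots,K\}$ be partitioned into disjoint sets $J_1,J_2,J_3,J_4$, and let $X = \ell(L_1,\ldots,L_K)\cdot Q$ be a HOLQ junior corresponding to this partition. Assume the model $X \sim N_{p_1\times\cdots\times p_K}(0,\sigma^2\Sigma_K\otimes\cdots\otimes\Sigma_1)$ with unknown $\sigma^2>0$ and unknown $\Sigma_k$ in $\mathcal{S}_{p_k}^1$, $\mathcal{D}_{p_k}^+$, $\mathcal{S}_{p_k}^{Ch}$, or $\{I_{p_k}\}$ when $k$ is in $J_1$, $J_2$, $J_3$, or $J_4$, respectively. Then: 1. The MLE of $\Sigma_k$ is $L_kL_k^T$ for $k = 1,\ldots,K$. 2. The MLE of $\sigma^2$ is $\hat\sigma^2=\ell^2 / p$. 3. The maximum of the likelihood is equal to $$\left(2 \pi \hat{\sigma}^2\right)^{-p/2}e^{-p/2} = \left(2 \pi \ell^2/p\right)^{-p/2}e^{-p/2}.$$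
   Context: $\|\cdot\|$ is the Frobenius norm. $\mathcal{G}_{p}^+$: $p\times p$ real lower triangular matrices with positive diagonal elements and unit determinant. $\mathcal{D}_{p}^+$: $p\times p$ positive definite diagonal matrices with unit determinant. $\mathcal{G}_{p}^{Ch}$: $p\times p$ lower triangular matrices with unit diagonal. $\mathcal{S}_p^1$: $p\times p$ symmetric positive definite matrices with unit determinant. $\mathcal{S}_p^{Ch}$: $p\times p$ symmetric positive definite matrices whose lower triangular Cholesky square roots have unit diagonal. For matrices $A_k \in \mathbb{R}^{p_k \times p_k}$ and $Y \in \mathbb{R}^{p_1\times\cdots\times p_K}$, multilinear multiplication $(A_1,\ldots,A_K)\cdot Y$ is the array with entries $\sum_{i_1,\ldots,i_K} Y_{[i_1,\ldots,i_K]}A_{1[j_1,i_1]}\cdots A_{K[j_K,i_K]}$. HOLQ junior: the sets $J_1,\ldots,J_4$ may be empty. Let $\mathcal{G}^{(k)} = \mathcal{G}_{p_k}^+$, $\mathcal{D}_{p_k}^+$, $\mathcal{G}_{p_k}^{Ch}$, or $\{I_{p_k}\}$ if $k$ is in $J_1$, $J_2$, $J_3$, or $J_4$, respectively. If $(L_1,\ldots,L_K)$ attains the minimum $$(L_1,\ldots,L_K) = \operatorname*{arg\,min}_{\tilde{L}_k \in \mathcal{G}^{(k)},\ k=1,\ldots,K}\| (\tilde{L}_1^{-1},\ldots,\tilde{L}_K^{-1}) \cdot X\|,$$ then $X = \ell (L_1,\ldots,L_K) \cdot Q$ is a HOLQ junior, where $\ell = \| (L_1^{-1},\ldots,L_K^{-1})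 \cdot X\|$ and $Q = (L_1^{-1},\ldots,L_K^{-1}) \cdot X / \ell$. It is understood that the minimizer exists and $\ell>0$. Model: $X \sim N_{p_1\times\cdots\times p_K}(0,\sigma^2\Sigma_K\otimes\cdots\otimes\Sigma_1)$ means that $\mathrm{vec}(X)\in\mathbb{R}^p$ (stacking entries with the first index varying fastest) is mean-zero normal with covariance $\sigma^2(\Sigma_K\otimes\cdots\otimes\Sigma_1)$. The MLE is the parameter value maximizing the density of $X$ (the likelihood) over the stated parameter space. *)

theory Defs
  imports
    Complex_Main
    "HOL-Library.FuncSet"
    "HOL-Library.Disjoint_Sets"
    "Jordan_Normal_Form.Determinant"
    "Jordan_Normal_Form.Gauss_Jordan_Elimination"
begin

section \<open>Classes of matrices\<close>

text \<open>Only ever applied to invertible matrices.\<close>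

definition inv_mat :: "real mat \<Rightarrow> real mat" where
  "inv_mat A = the (mat_inverse A)"

definition lower_triangular :: "real mat \<Rightarrow> bool" where
  "lower_triangular A \<longleftrightarrow> (\<forall>i < dim_row A. \<forall>j < dim_col A. i < j \<longrightarrow> A $$ (i, j) = 0)"

definition sym_pos_def :: "nat \<Rightarrow> real mat set" where
  "sym_pos_def n = {A \<in> carrier_mat n n. A\<^sup>T = A \<and>
     (\<forall>v \<in> carrier_vec n. v \<noteq> 0\<^sub>v n \<longrightarrow> v \<bullet> (A *\<^sub>v v) > 0)}"

definition cholesky_root :: "nat \<Rightarrow> real mat \<Rightarrow> real mat \<Rightarrow> bool" where
  "cholesky_root n A L \<longleftrightarrow> L \<in> carrier_mat n n \<and> lower_triangular L \<and>
     (\<forall>i < n. L $$ (i, i) > 0) \<and> A = L * L\<^sup>T"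

definition G_plus :: "nat \<Rightarrow> real mat set" where
  "G_plus n = {A \<in> carrier_mat n n. lower_triangular A \<and> (\<forall>i < n. A $$ (i, i) > 0) \<and> det A = 1}"

definition D_plus :: "nat \<Rightarrow> real mat set" where
  "D_plus n = {A \<in> sym_pos_def n. diagonal_mat A \<and> det A = 1}"

definition G_Ch :: "nat \<Rightarrow> real mat set" where
  "G_Ch n = {A \<in> carrier_mat n n. lower_triangular A \<and> (\<forall>i < n. A $$ (i, i) = 1)}"

definition S_one :: "nat \<Rightarrow> real mat set" where
  "S_one n = {A \<in> sym_pos_def n. det A = 1}"

text \<open>A positive definite matrix has exactly one Cholesky root, so the existential
  quantifier speaks about that root.\<close>

definition S_Ch :: "nat \<Rightarrow> real mat set" where
  "S_Ch n = {A \<in> sym_pos_def n. \<exists>L. cholesky_root n A L \<and> (\<forall>i < n. L $$ (i, i) = 1)}"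

section \<open>Arrays\<close>

text \<open>Modes are numbered \<open>1, \<dots>, K\<close>; along mode \<open>k\<close> the coordinates run through \<open>0, \<dots>, p k - 1\<close>,
  in accordance with the row and column indices of \<open>mat\<close>. An array is a function on
  multi-indices which is \<open>undefined\<close> off the index set. A tuple of matrices, one for each mode,
  is a function whose values off \<open>{1..K}\<close> are irrelevant.\<close>

definition multi_idx :: "nat \<Rightarrow> (nat \<Rightarrow> nat) \<Rightarrow> (nat \<Rightarrow> nat) set" where
  "multi_idx K p = (\<Pi>\<^sub>E k\<in>{1..K}. {..<p k})"

definition arrays :: "nat \<Rightarrow> (nat \<Rightarrow> nat) \<Rightarrow> ((nat \<Rightarrow> nat) \<Rightarrow> real) set" where
  "arrays K p = multi_idx K p \<rightarrow>\<^sub>E UNIV"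

definition total_dim :: "nat \<Rightarrow> (nat \<Rightarrow> nat) \<Rightarrow> nat" where
  "total_dim K p = (\<Prod>k\<in>{1..K}. p k)"

definition mlmult ::
    "nat \<Rightarrow> (nat \<Rightarrow> nat) \<Rightarrow> (nat \<Rightarrow> real mat) \<Rightarrow> ((nat \<Rightarrow> nat) \<Rightarrow> real) \<Rightarrow> (nat \<Rightarrow> nat) \<Rightarrow> real" where
  "mlmult K p A Y =
     (\<lambda>j\<in>multi_idx K p. \<Sum>i\<in>multi_idx K p. Y i * (\<Prod>k\<in>{1..K}. A k $$ (j k, i k)))"

definition array_scale ::
    "nat \<Rightarrow> (nat \<Rightarrow> nat) \<Rightarrow> real \<Rightarrow> ((nat \<Rightarrow> nat) \<Rightarrow> real) \<Rightarrow> (nat \<Rightarrow> nat) \<Rightarrow> real" where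
  "array_scale K p c Y = (\<lambda>i\<in>multi_idx K p. c * Y i)"

definition frob_norm :: "nat \<Rightarrow> (nat \<Rightarrow> nat) \<Rightarrow> ((nat \<Rightarrow> nat) \<Rightarrow> real) \<Rightarrow> real" where
  "frob_norm K p Y = sqrt (\<Sum>i\<in>multi_idx K p. (Y i)\<^sup>2)"

section \<open>HOLQ juniors\<close>

definition holq_space :: "(nat \<Rightarrow> nat) \<Rightarrow> (nat \<Rightarrow> nat set) \<Rightarrow> nat \<Rightarrow> real mat set" where
  "holq_space p J k =
     (if k \<in> J 1 then G_plus (p k)
      else if k \<in> J 2 then D_plus (p k)
      else if k \<in> J 3 then G_Ch (p k)
      else {1\<^sub>m (p k)})"

definition holq_residual ::
    "nat \<Rightarrow> (nat \<Rightarrow> nat) \<Rightarrow> ((nat \<Rightarrow> nat) \<Rightarrow> real) \<Rightarrow> (nat \<Rightarrow> real mat) \<Rightarrow> (nat \<Rightarrow> nat) \<Rightarrow> real" where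
  "holq_residual K p X L = mlmult K p (\<lambda>k. inv_mat (L k)) X"

definition holq_junior ::
    "nat \<Rightarrow> (nat \<Rightarrow> nat) \<Rightarrow> (nat \<Rightarrow> nat set) \<Rightarrow> ((nat \<Rightarrow> nat) \<Rightarrow> real) \<Rightarrow>
     real \<Rightarrow> (nat \<Rightarrow> real mat) \<Rightarrow> ((nat \<Rightarrow> nat) \<Rightarrow> real) \<Rightarrow> bool" where
  "holq_junior K p J X l L Q \<longleftrightarrow>
     is_arg_min (\<lambda>M. frob_norm K p (holq_residual K p X M))
       (\<lambda>M. M \<in> (\<Pi> k\<in>{1..K}. holq_space p J k)) L \<and>
     l = frob_norm K p (holq_residual K p X L) \<and> l > 0 \<and>
     Q = array_scale K p (1 / l) (holq_residual K p X L) \<and>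
     X = array_scale K p l (mlmult K p L Q)"

section \<open>The array normal model\<close>

text \<open>Coordinate \<open>k\<close> of the multi-index at position \<open>i\<close> of the vectorization, the first mode
  varying fastest.\<close>

definition unvec_idx :: "nat \<Rightarrow> (nat \<Rightarrow> nat) \<Rightarrow> nat \<Rightarrow> nat \<Rightarrow> nat" where
  "unvec_idx K p i = (\<lambda>k\<in>{1..K}. (i div (\<Prod>m\<in>{1..<k}. p m)) mod p k)"

definition vectorize :: "nat \<Rightarrow> (nat \<Rightarrow> nat) \<Rightarrow> ((nat \<Rightarrow> nat) \<Rightarrow> real) \<Rightarrow> real vec" where
  "vectorize K p X = vec (total_dim K p) (\<lambda>i. X (unvec_idx K p i))"

definition kron :: "real mat \<Rightarrow> real mat \<Rightarrow> real mat" where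
  "kron A B = mat (dim_row A * dim_row B) (dim_col A * dim_col B)
     (\<lambda>(i, j). A $$ (i div dim_row B, j div dim_col B) * B $$ (i mod dim_row B, j mod dim_col B))"

text \<open>\<open>kron_prod S K\<close> is the product of \<open>S K\<close>, \dots, \<open>S 1\<close> in this order.\<close>

fun kron_prod :: "(nat \<Rightarrow> real mat) \<Rightarrow> nat \<Rightarrow> real mat" where
  "kron_prod S 0 = 1\<^sub>m 1"
| "kron_prod S (Suc k) = kron (S (Suc k)) (kron_prod S k)"

text \<open>The Lebesgue density at \<open>x\<close> of the normal distribution with mean zero and positive definite
  covariance matrix \<open>C\<close>.\<close>

definition normal_density_vec :: "real mat \<Rightarrow> real vec \<Rightarrow> real" where
  "normal_density_vec C x =
     (2 * pi) powr (- (real (dim_vec x) / 2)) * det C powr (- (1 / 2)) *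
     exp (- (x \<bullet> (inv_mat C *\<^sub>v x)) / 2)"

definition cov_space :: "(nat \<Rightarrow> nat) \<Rightarrow> (nat \<Rightarrow> nat set) \<Rightarrow> nat \<Rightarrow> real mat set" where
  "cov_space p J k =
     (if k \<in> J 1 then S_one (p k)
      else if k \<in> J 2 then D_plus (p k)
      else if k \<in> J 3 then S_Ch (p k)
      else {1\<^sub>m (p k)})"

definition param_space ::
    "nat \<Rightarrow> (nat \<Rightarrow> nat) \<Rightarrow> (nat \<Rightarrow> nat set) \<Rightarrow> (real \<times> (nat \<Rightarrow> real mat)) set" where
  "param_space K p J = {0<..} \<times> (\<Pi> k\<in>{1..K}. cov_space p J k)"

definition likelihood ::
    "nat \<Rightarrow> (nat \<Rightarrow> nat) \<Rightarrow> ((nat \<Rightarrow> nat) \<Rightarrow> real) \<Rightarrow> real \<times> (nat \<Rightarrow> real mat) \<Rightarrow> real" where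
  "likelihood K p X = (\<lambda>(s, S). normal_density_vec (s \<cdot>\<^sub>m kron_prod S K) (vectorize K p X))"

text \<open>\<open>s\<close> is the estimate of the scale parameter \<open>\<sigma>\<^sup>2\<close>, not of \<open>\<sigma>\<close>.\<close>

definition is_MLE ::
    "nat \<Rightarrow> (nat \<Rightarrow> nat) \<Rightarrow> (nat \<Rightarrow> nat set) \<Rightarrow> ((nat \<Rightarrow> nat) \<Rightarrow> real) \<Rightarrow>
     real \<Rightarrow> (nat \<Rightarrow> real mat) \<Rightarrow> bool" where
  "is_MLE K p J X s S \<longleftrightarrow>
     is_arg_max (likelihood K p X) (\<lambda>\<theta>. \<theta> \<in> param_space K p J) (s, S)"

end

theory Submission
  imports Defs
begin

text \<open>Writing each \<open>\<Sigma>\<^sub>k\<close> as \<open>M\<^sub>k M\<^sub>k\<^sup>T\<close> turns maximizing the likelihood into the minimization that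
  defines a HOLQ junior. For each of the four classes of covariance matrices the map
  \<open>M \<mapsto> M M\<^sup>T\<close> sends the corresponding class of factors onto it (\<open>gram_in_cov_space\<close>,
  \<open>cov_space_gram\<close>; the latter rests on the existence of Cholesky roots). All the factors are lower
  triangular with determinant one, and so is their Kronecker product; hence the determinant of the
  covariance matrix sees only \<open>\<sigma>\<^sup>2\<close>, and the exponent sees the \<open>\<Sigma>\<^sub>k\<close> only through the norm
  \<open>r(M)\<close> of \<open>(M\<^sub>1\<^sup>-\<^sup>1, \<dots>, M\<^sub>K\<^sup>-\<^sup>1) \<cdot> X\<close>. With \<open>p\<close> the number of entries of \<open>X\<close>, the likelihood is
  (\<open>likelihood_gram\<close>)
  \<open>(2 \<pi> \<sigma>\<^sup>2) powr (- p / 2) * exp (- r(M)\<^sup>2 / (2 \<sigma>\<^sup>2))\<close>.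

  For fixed \<open>\<sigma>\<^sup>2\<close> this is largest when \<open>r(M)\<close> is least, that is when \<open>r(M) = \<ell>\<close>, which is attained at
  the HOLQ factors \<open>L\<close>. The function of \<open>\<sigma>\<^sup>2\<close> that remains has its maximum exactly at \<open>\<ell>\<^sup>2 / p\<close>, by
  \<open>ln u \<le> u - 1\<close> with equality only for \<open>u = 1\<close> (\<open>gaussian_scale_bound\<close>). The same bound shows
  that no other value of \<open>\<sigma>\<^sup>2\<close> occurs in a maximizer.\<close>

section \<open>Vectorization and Kronecker products\<close>

lemma total_dim_0 [simp]: "total_dim 0 p = 1"
  by (simp add: total_dim_def)

lemma total_dim_Suc: "total_dim (Suc K) p = p (Suc K) * total_dim K p"
  by (simp add: total_dim_def)

lemma kron_carrier:
  assumes "A \<in> carrier_mat m m'" "B \<in> carrier_mat n n'"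
  shows "kron A B \<in> carrier_mat (m * n) (m' * n')"
  using assms by (auto simp: kron_def)

lemma kron_prod_carrier:
  assumes "\<And>k. k \<in> {1..K} \<Longrightarrow> A k \<in> carrier_mat (p k) (p k)"
  shows "kron_prod A K \<in> carrier_mat (total_dim K p) (total_dim K p)"
  using assms by (induction K) (auto simp: total_dim_Suc intro!: kron_carrier)

text \<open>Reducing modulo a multiple of \<open>a * b\<close> only discards mixed-radix digits above the one with
  place value \<open>a\<close> and radix \<open>b\<close>.\<close>

lemma digit_mod:
  fixes i a b c :: nat
  shows "(i mod (a * b * c)) div a mod b = i div a mod b"
proof (cases "a = 0")
  case False
  have "i mod (a * (b * c)) = a * ((i div a) mod (b * c)) + i mod a"
    by (rule mod_mult2_eq)
  with False show ?thesis
    by (simp add: mult.assoc mod_mod_cancel)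
qed simp

text \<open>Together with the next lemma this splits a position into its top coordinate and its position
  in an array with one mode less, which is the index arithmetic in the definition of \<^const>\<open>kron\<close>.\<close>

lemma unvec_idx_lower_digit:
  assumes "k \<in> {1..K}"
  shows "unvec_idx K p (i mod total_dim K p) k = unvec_idx (Suc K) p i k"
proof -
  have "{1..K} = insert k {1..<k} \<union> {Suc k..K}"
    using assms by auto
  then have "total_dim K p = (\<Prod>m\<in>insert k {1..<k}. p m) * (\<Prod>m\<in>{Suc k..K}. p m)"
    unfolding total_dim_def by (simp only:, subst prod.union_disjoint) auto
  then have "total_dim K p = (\<Prod>m\<in>{1..<k}. p m) * p k * (\<Prod>m\<in>{Suc k..K}. p m)"
    by (simp add: mult.commute)
  then show ?thesis
    using assms by (simp add: unvec_idx_def digit_mod)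
qed

lemma unvec_idx_top_digit:
  assumes "i < total_dim (Suc K) p"
  shows "unvec_idx (Suc K) p i (Suc K) = i div total_dim K p"
  using assms
  by (simp add: unvec_idx_def total_dim_def atLeastLessThanSuc_atLeastAtMost less_mult_imp_div_less mult.commute)

lemma unvec_idx_inj:
  "inj_on (unvec_idx K p) {..<total_dim K p}"
proof (induction K)
  case 0
  then show ?case by (auto simp: inj_on_def)
next
  case (Suc K)
  show ?case
  proof (rule inj_onI)
    fix i j
    assume ij: "i \<in> {..<total_dim (Suc K) p}" "j \<in> {..<total_dim (Suc K) p}"
      and eq: "unvec_idx (Suc K) p i = unvec_idx (Suc K) p j"
    then have pos: "0 < total_dim K p"
      by (auto simp: total_dim_Suc intro!: Nat.gr0I)
    have "unvec_idx K p (i mod total_dim K p) k = unvec_idx K p (j mod total_dim K p) k" for k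
    proof (cases "k \<in> {1..K}")
      case True
      then show ?thesis by (simp add: unvec_idx_lower_digit eq)
    next
      case False
      then show ?thesis unfolding unvec_idx_def by (simp only: restrict_apply if_False)
    qed
    then have "i mod total_dim K p = j mod total_dim K p"
      using Suc.IH pos by (auto simp: inj_on_def fun_eq_iff)
    moreover have "i div total_dim K p = j div total_dim K p"
      using eq ij by (metis unvec_idx_top_digit lessThan_iff)
    ultimately show "i = j"
      by (metis div_mult_mod_eq)
  qed
qed

lemma finite_multi_idx: "finite (multi_idx K p)"
  by (simp add: multi_idx_def finite_PiE)

text \<open>Surjectivity comes from counting: an injection between finite sets of equal size is onto. This
  bijection turns every sum over positions of the vectorization into a sum over multi-indices.\<close>

lemma unvec_idx_bij:
  "bij_betw (unvec_idx K p) {..<total_dim K p} (multi_idx K p)"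
  unfolding bij_betw_def
proof
  show inj: "inj_on (unvec_idx K p) {..<total_dim K p}"
    by (rule unvec_idx_inj)
  show "unvec_idx K p ` {..<total_dim K p} = multi_idx K p"
  proof (rule card_subset_eq[OF finite_multi_idx])
    show "unvec_idx K p ` {..<total_dim K p} \<subseteq> multi_idx K p"
    proof
      fix x
      assume "x \<in> unvec_idx K p ` {..<total_dim K p}"
      then obtain i where i: "i < total_dim K p" "x = unvec_idx K p i" by auto
      then have "0 < p k" if "k \<in> {1..K}" for k
        using that i(1) unfolding total_dim_def
        by (metis finite_atLeastAtMost not_gr_zero not_less_zero prod_zero_iff)
      with i show "x \<in> multi_idx K p"
        by (auto simp: multi_idx_def unvec_idx_def)
    qed
    show "card (unvec_idx K p ` {..<total_dim K p}) = card (multi_idx K p)"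
      unfolding card_image[OF inj] by (simp add: multi_idx_def card_PiE total_dim_def)
  qed
qed

text \<open>Everything about Kronecker products that involves sums is read off from this formula: the row
  and column positions are decoded once and the modes then separate.\<close>

lemma kron_prod_entry:
  assumes "\<And>k. k \<in> {1..K} \<Longrightarrow> A k \<in> carrier_mat (p k) (p k)"
    and "i < total_dim K p" "j < total_dim K p"
  shows "kron_prod A K $$ (i, j) = (\<Prod>k\<in>{1..K}. A k $$ (unvec_idx K p i k, unvec_idx K p j k))"
  using assms
proof (induction K arbitrary: i j)
  case 0
  then show ?case by simp
next
  case (Suc K)
  let ?P = "total_dim K p"
  have M: "kron_prod A K \<in> carrier_mat ?P ?P"
    using Suc.prems(1) by (intro kron_prod_carrier) auto
  have S: "A (Suc K) \<in> carrier_mat (p (Suc K)) (p (Suc K))"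
    using Suc.prems(1) by simp
  have pos: "0 < ?P"
    using Suc.prems(2) by (auto simp: total_dim_Suc intro!: Nat.gr0I)
  have "kron_prod A (Suc K) $$ (i, j)
      = A (Suc K) $$ (i div ?P, j div ?P) * kron_prod A K $$ (i mod ?P, j mod ?P)"
    using M S Suc.prems(2,3) by (simp add: kron_def total_dim_Suc)
  also have "kron_prod A K $$ (i mod ?P, j mod ?P)
      = (\<Prod>k\<in>{1..K}. A k $$ (unvec_idx (Suc K) p i k, unvec_idx (Suc K) p j k))"
    using Suc.prems(1) pos by (subst Suc.IH) (auto intro!: prod.cong simp: unvec_idx_lower_digit)
  finally show ?case
    using Suc.prems by (simp add: unvec_idx_top_digit)
qed

lemma kron_prod_cong:
  assumes "\<And>k. k \<in> {1..K} \<Longrightarrow> A k = B k"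
  shows "kron_prod A K = kron_prod B K"
  using assms by (induction K) auto

text \<open>The mixed-product property. After decoding the summation position, the sum over multi-indices
  of a product over modes factors into a product of sums, one for each mode.\<close>

lemma kron_prod_mult:
  assumes A: "\<And>k. k \<in> {1..K} \<Longrightarrow> A k \<in> carrier_mat (p k) (p k)"
    and B: "\<And>k. k \<in> {1..K} \<Longrightarrow> B k \<in> carrier_mat (p k) (p k)"
  shows "kron_prod (\<lambda>k. A k * B k) K = kron_prod A K * kron_prod B K"
proof (rule eq_matI)
  let ?P = "total_dim K p" and ?u = "unvec_idx K p"
  have AB: "A k * B k \<in> carrier_mat (p k) (p k)" if "k \<in> {1..K}" for k
    using A[OF that] B[OF that] by simp
  have dims: "kron_prod A K \<in> carrier_mat ?P ?P" "kron_prod B K \<in> carrier_mat ?P ?P"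
    "kron_prod (\<lambda>k. A k * B k) K \<in> carrier_mat ?P ?P"
    using kron_prod_carrier[of K A p, OF A] kron_prod_carrier[of K B p, OF B]
      kron_prod_carrier[of K "\<lambda>k. A k * B k" p, OF AB] by simp_all
  then show "dim_row (kron_prod (\<lambda>k. A k * B k) K) = dim_row (kron_prod A K * kron_prod B K)"
    "dim_col (kron_prod (\<lambda>k. A k * B k) K) = dim_col (kron_prod A K * kron_prod B K)"
    by auto
  fix i j
  assume "i < dim_row (kron_prod A K * kron_prod B K)" "j < dim_col (kron_prod A K * kron_prod B K)"
  then have i: "i < ?P" and j: "j < ?P" using dims by auto
  have u: "?u i k < p k" if "i < ?P" "k \<in> {1..K}" for i k
    using bij_betwE[OF unvec_idx_bij[of K p]] that PiE_mem[of "?u i" "{1..K}" "\<lambda>k. {..<p k}" k]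
    by (simp add: multi_idx_def)
  have "(kron_prod A K * kron_prod B K) $$ (i, j)
      = (\<Sum>m<?P. kron_prod A K $$ (i, m) * kron_prod B K $$ (m, j))"
    using dims i j by (auto simp: scalar_prod_def lessThan_atLeast0)
  also have "\<dots> = (\<Sum>m<?P. \<Prod>k\<in>{1..K}. A k $$ (?u i k, ?u m k) * B k $$ (?u m k, ?u j k))"
    using kron_prod_entry[of K A p, OF A i] kron_prod_entry[of K B p, OF B _ j]
    by (intro sum.cong) (auto simp: prod.distrib)
  also have "\<dots> = (\<Sum>h\<in>multi_idx K p. \<Prod>k\<in>{1..K}. A k $$ (?u i k, h k) * B k $$ (h k, ?u j k))"
    by (rule sum.reindex_bij_betw[OF unvec_idx_bij])
  also have "\<dots> = (\<Prod>k\<in>{1..K}. \<Sum>m<p k. A k $$ (?u i k, m) * B k $$ (m, ?u j k))"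
    unfolding multi_idx_def by (subst prod_sum_PiE) auto
  also have "\<dots> = (\<Prod>k\<in>{1..K}. (A k * B k) $$ (?u i k, ?u j k))"
  proof (rule prod.cong)
    fix k assume k: "k \<in> {1..K}"
    show "(\<Sum>m<p k. A k $$ (?u i k, m) * B k $$ (m, ?u j k)) = (A k * B k) $$ (?u i k, ?u j k)"
      using A[OF k] B[OF k] u[OF i k] u[OF j k] by (auto simp: scalar_prod_def lessThan_atLeast0)
  qed simp
  also have "\<dots> = kron_prod (\<lambda>k. A k * B k) K $$ (i, j)"
    using kron_prod_entry[OF AB i j] by simp
  finally show "kron_prod (\<lambda>k. A k * B k) K $$ (i, j) = (kron_prod A K * kron_prod B K) $$ (i, j)"
    by simp
qed

lemma kron_transpose: "(kron A B)\<^sup>T = kron (A\<^sup>T) (B\<^sup>T)"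
proof (rule eq_matI)
  fix i j
  assume "i < dim_row (kron (A\<^sup>T) (B\<^sup>T))" "j < dim_col (kron (A\<^sup>T) (B\<^sup>T))"
  then have ij: "i < dim_col A * dim_col B" "j < dim_row A * dim_row B"
    by (auto simp: kron_def)
  then have "0 < dim_col B" "0 < dim_row B"
    by (auto intro!: Nat.gr0I)
  with ij show "(kron A B)\<^sup>T $$ (i, j) = kron (A\<^sup>T) (B\<^sup>T) $$ (i, j)"
    by (simp add: kron_def less_mult_imp_div_less)
qed (auto simp: kron_def)

lemma kron_prod_transpose: "kron_prod (\<lambda>k. (A k)\<^sup>T) K = (kron_prod A K)\<^sup>T"
  by (induction K) (auto simp: kron_transpose)

lemma kron_one: "kron (1\<^sub>m m) (1\<^sub>m n) = 1\<^sub>m (m * n)"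
proof (rule eq_matI)
  fix i j
  assume "i < dim_row (1\<^sub>m (m * n) :: real mat)" "j < dim_col (1\<^sub>m (m * n) :: real mat)"
  then have ij: "i < m * n" "j < m * n" by auto
  then have "0 < n" by (auto intro!: Nat.gr0I)
  moreover have "i = j" if "i div n = j div n" "i mod n = j mod n"
    using that by (metis div_mult_mod_eq)
  ultimately show "kron (1\<^sub>m m) (1\<^sub>m n) $$ (i, j) = 1\<^sub>m (m * n) $$ (i, j)"
    using ij by (auto simp: kron_def less_mult_imp_div_less)
qed (auto simp: kron_def)

lemma kron_prod_one:
  "kron_prod (\<lambda>k. 1\<^sub>m (p k)) K = 1\<^sub>m (total_dim K p)"
  by (induction K) (auto simp: kron_one total_dim_Suc)

lemma det_lower_triangular_prod:
  assumes "A \<in> carrier_mat n n" "lower_triangular A"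
  shows "det A = (\<Prod>i<n. A $$ (i, i))"
proof -
  have "det A = prod_list (diag_mat A)"
    by (rule det_lower_triangular[of n]) (use assms in \<open>auto simp: lower_triangular_def\<close>)
  then show ?thesis
    using assms by (simp add: prod_list_diag_prod lessThan_atLeast0)
qed
lemma kron_lower_triangular:
  assumes "A \<in> carrier_mat m m" "B \<in> carrier_mat n n" "lower_triangular A" "lower_triangular B"
  shows "lower_triangular (kron A B)"
  unfolding lower_triangular_def
proof (intro allI impI)
  fix i j
  assume "i < dim_row (kron A B)" "j < dim_col (kron A B)" and less: "i < j"
  then have ij: "i < m * n" "j < m * n"
    using assms by (auto simp: kron_def)
  then have n: "0 < n" by (auto intro!: Nat.gr0I)
  have "i div n < j div n \<or> (i div n = j div n \<and> i mod n < j mod n)"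
    using less div_le_mono[of i j n] by (metis div_mult_mod_eq le_neq_implies_less less_imp_le nat_add_left_cancel_less)
  then have "A $$ (i div n, j div n) = 0 \<or> B $$ (i mod n, j mod n) = 0"
    using assms ij n by (auto simp: lower_triangular_def less_mult_imp_div_less)
  then show "kron A B $$ (i, j) = 0"
    using assms ij by (auto simp: kron_def)
qed

text \<open>For triangular factors the determinant is the product over the diagonal, whose entries at
  \<open>a * n + b\<close> are \<open>A $$ (a, a) * B $$ (b, b)\<close>. Cholesky roots are triangular, so this covers them.\<close>

lemma det_kron_lower_triangular:
  assumes A: "A \<in> carrier_mat m m" "lower_triangular A" and B: "B \<in> carrier_mat n n" "lower_triangular B"
  shows "det (kron A B) = det A ^ n * det B ^ m"
proof -
  have "det (kron A B) = (\<Prod>i<m * n. kron A B $$ (i, i))"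
    using A B by (intro det_lower_triangular_prod kron_carrier kron_lower_triangular)
  also have "\<dots> = (\<Prod>i<m * n. A $$ (i div n, i div n) * B $$ (i mod n, i mod n))"
    using A B by (intro prod.cong) (auto simp: kron_def)
  also have "\<dots> = (\<Prod>a<m. \<Prod>i\<in>{a * n..<a * n + n}. A $$ (i div n, i div n) * B $$ (i mod n, i mod n))"
    by (rule prod.nat_group[symmetric])
  also have "\<dots> = (\<Prod>a<m. \<Prod>b<n. A $$ (a, a) * B $$ (b, b))"
  proof (rule prod.cong[OF refl])
    fix a
    show "(\<Prod>i\<in>{a * n..<a * n + n}. A $$ (i div n, i div n) * B $$ (i mod n, i mod n))
      = (\<Prod>b<n. A $$ (a, a) * B $$ (b, b))"
    proof (rule prod.reindex_bij_witness[of _ "\<lambda>b. a * n + b" "\<lambda>i. i - a * n"])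
      fix i
      assume "i \<in> {a * n..<a * n + n}"
      then have div: "i div n = a"
        by (auto intro!: div_nat_eqI simp: mult.commute)
      then have "i mod n = i - a * n"
        by (metis minus_div_mult_eq_mod)
      with div show "A $$ (a, a) * B $$ (i - a * n, i - a * n)
          = A $$ (i div n, i div n) * B $$ (i mod n, i mod n)"
        by simp
    qed auto
  qed
  also have "\<dots> = det A ^ n * det B ^ m"
    using A B by (simp add: det_lower_triangular_prod prod.distrib prod_power_distrib)
  finally show ?thesis .
qed

lemma kron_prod_unit_det:
  assumes "\<And>k. k \<in> {1..K} \<Longrightarrow> A k \<in> carrier_mat (p k) (p k)"
    and "\<And>k. k \<in> {1..K} \<Longrightarrow> lower_triangular (A k)"
    and "\<And>k. k \<in> {1..K} \<Longrightarrow> det (A k) = 1"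
  shows "lower_triangular (kron_prod A K) \<and> det (kron_prod A K) = 1"
  using assms
proof (induction K)
  case 0
  then show ?case by (simp add: lower_triangular_def)
next
  case (Suc K)
  have "kron_prod A K \<in> carrier_mat (total_dim K p) (total_dim K p)"
    using Suc.prems(1) by (intro kron_prod_carrier) auto
  moreover have "A (Suc K) \<in> carrier_mat (p (Suc K)) (p (Suc K))"
    using Suc.prems(1) by simp
  moreover have "lower_triangular (kron_prod A K) \<and> det (kron_prod A K) = 1"
    using Suc by simp
  ultimately show ?case
    using Suc.prems(2,3)
    by (auto simp: det_kron_lower_triangular[of _ "p (Suc K)" _ "total_dim K p"]
        intro!: kron_lower_triangular[of _ "p (Suc K)" _ "total_dim K p"])
qed

text \<open>Multilinear multiplication is multiplication by the Kronecker product, in the ordering of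
  modes that \<^const>\<open>vectorize\<close> and \<^const>\<open>kron_prod\<close> share.\<close>

lemma kron_prod_mult_vectorize:
  assumes A: "\<And>k. k \<in> {1..K} \<Longrightarrow> A k \<in> carrier_mat (p k) (p k)"
  shows "kron_prod A K *\<^sub>v vectorize K p X = vectorize K p (mlmult K p A X)"
proof (rule eq_vecI)
  let ?P = "total_dim K p" and ?u = "unvec_idx K p"
  note W = kron_prod_carrier[of K A p, OF A]
  then show "dim_vec (kron_prod A K *\<^sub>v vectorize K p X) = dim_vec (vectorize K p (mlmult K p A X))"
    by (simp add: vectorize_def)
  fix i
  assume "i < dim_vec (vectorize K p (mlmult K p A X))"
  then have i: "i < ?P" by (simp add: vectorize_def)
  have "(kron_prod A K *\<^sub>v vectorize K p X) $ i = (\<Sum>m<?P. kron_prod A K $$ (i, m) * X (?u m))"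
    using W i by (auto simp: scalar_prod_def vectorize_def lessThan_atLeast0)
  also have "\<dots> = (\<Sum>m<?P. X (?u m) * (\<Prod>k\<in>{1..K}. A k $$ (?u i k, ?u m k)))"
    using kron_prod_entry[of K A p, OF A i] by (intro sum.cong) auto
  also have "\<dots> = (\<Sum>h\<in>multi_idx K p. X h * (\<Prod>k\<in>{1..K}. A k $$ (?u i k, h k)))"
    by (rule sum.reindex_bij_betw[OF unvec_idx_bij])
  also have "\<dots> = mlmult K p A X (?u i)"
    using bij_betwE[OF unvec_idx_bij[of K p]] i by (simp add: mlmult_def)
  finally show "(kron_prod A K *\<^sub>v vectorize K p X) $ i = vectorize K p (mlmult K p A X) $ i"
    using i by (simp add: vectorize_def)
qed

lemma vectorize_sq_norm:
  "vectorize K p Y \<bullet> vectorize K p Y = (frob_norm K p Y)\<^sup>2"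
proof -
  have "vectorize K p Y \<bullet> vectorize K p Y = (\<Sum>i<total_dim K p. (Y (unvec_idx K p i))\<^sup>2)"
    by (simp add: scalar_prod_def vectorize_def lessThan_atLeast0 power2_eq_square)
  also have "\<dots> = (\<Sum>h\<in>multi_idx K p. (Y h)\<^sup>2)"
    by (rule sum.reindex_bij_betw[OF unvec_idx_bij])
  finally show ?thesis
    by (simp add: frob_norm_def sum_nonneg)
qed

section \<open>Cholesky factors and the covariance classes\<close>

text \<open>Induction on the size by elimination of the first coordinate: the first column of the factor is
  forced, and what remains to be factored is the Schur complement \<open>B\<close> of the top left entry. Its
  quadratic form at \<open>w\<close> is the value of the form of \<open>A\<close> at an extension of \<open>w\<close> by one coordinate,
  hence positive. Functions on pairs of indices let the indices shift by \<^const>\<open>Suc\<close> without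
  block matrices.\<close>

lemma cholesky_factor_exists:
  fixes A :: "nat \<Rightarrow> nat \<Rightarrow> real"
  assumes "\<And>i j. i < n \<Longrightarrow> j < n \<Longrightarrow> A i j = A j i"
    and "\<And>v :: nat \<Rightarrow> real. (\<exists>i<n. v i \<noteq> 0) \<Longrightarrow> 0 < (\<Sum>i<n. \<Sum>j<n. v i * A i j * v j)"
  shows "\<exists>L :: nat \<Rightarrow> nat \<Rightarrow> real. (\<forall>i<n. \<forall>k<n. i < k \<longrightarrow> L i k = 0) \<and> (\<forall>i<n. 0 < L i i) \<and>
           (\<forall>i<n. \<forall>j<n. A i j = (\<Sum>k<n. L i k * L j k))"
  using assms
proof (induction n arbitrary: A)
  case 0
  then show ?case by simp
next
  case (Suc n)
  note sym = Suc.prems(1) and pd = Suc.prems(2)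
  define a where "a = A 0 0"
  have "0 < (\<Sum>i<Suc n. \<Sum>j<Suc n. (if i = 0 then 1 else 0) * A i j * (if j = 0 then 1 else 0))"
    by (rule pd) auto
  then have a: "0 < a"
    by (simp only: sum.lessThan_Suc_shift) (simp add: a_def)
  define B where "B i j = A (Suc i) (Suc j) - A (Suc i) 0 * A 0 (Suc j) / a" for i j
  have "\<exists>M :: nat \<Rightarrow> nat \<Rightarrow> real. (\<forall>i<n. \<forall>k<n. i < k \<longrightarrow> M i k = 0) \<and> (\<forall>i<n. 0 < M i i) \<and>
           (\<forall>i<n. \<forall>j<n. B i j = (\<Sum>k<n. M i k * M j k))"
  proof (rule Suc.IH)
    show "B i j = B j i" if "i < n" "j < n" for i j
      using that sym[of "Suc i" "Suc j"] sym[of "Suc i" 0] sym[of 0 "Suc j"] by (simp add: B_def)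
  next
    fix w :: "nat \<Rightarrow> real"
    assume "\<exists>i<n. w i \<noteq> 0"
    then obtain i0 where i0: "i0 < n" "w i0 \<noteq> 0" by blast
    define c where "c = (\<Sum>j<n. A 0 (Suc j) * w j)"
    have c': "(\<Sum>i<n. w i * A (Suc i) 0) = c"
      unfolding c_def using sym by (intro sum.cong) (auto simp: mult.commute)
    \<comment> \<open>Completing the square: this is the first coordinate that minimizes the quadratic form.\<close>
    define v where "v i = (case i of 0 \<Rightarrow> - c / a | Suc i' \<Rightarrow> w i')" for i
    have v_Suc: "v (Suc i) = w i" for i by (simp add: v_def)
    define q where "q = (\<Sum>i<n. \<Sum>j<n. w i * A (Suc i) (Suc j) * w j)"
    have "0 < (\<Sum>i<Suc n. \<Sum>j<Suc n. v i * A i j * v j)"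
      by (rule pd, rule exI[of _ "Suc i0"]) (use i0 in \<open>auto simp: v_def\<close>)
    also have "\<dots> = (v 0 * a * v 0 + v 0 * c) + ((\<Sum>i<n. w i * A (Suc i) 0) * v 0 + q)"
      by (simp only: sum.lessThan_Suc_shift sum.distrib)
        (simp add: v_Suc a_def c_def q_def sum_distrib_left sum_distrib_right mult.assoc)
    also have "\<dots> = q - c * c / a"
      using a by (simp add: c' v_def field_simps)
    also have "c * c / a = (\<Sum>i<n. \<Sum>j<n. w i * (A (Suc i) 0 * A 0 (Suc j) / a) * w j)"
      by (subst c'[symmetric], subst c_def)
        (simp add: sum_product sum_divide_distrib mult.assoc)
    also have "q - \<dots> = (\<Sum>i<n. \<Sum>j<n. w i * B i j * w j)"
      by (simp add: q_def B_def sum_subtractf[symmetric] algebra_simps)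
    finally show "0 < (\<Sum>i<n. \<Sum>j<n. w i * B i j * w j)" .
  qed
  then obtain M :: "nat \<Rightarrow> nat \<Rightarrow> real" where
    M: "\<And>i k. i < n \<Longrightarrow> k < n \<Longrightarrow> i < k \<Longrightarrow> M i k = 0" "\<And>i. i < n \<Longrightarrow> 0 < M i i"
      "\<And>i j. i < n \<Longrightarrow> j < n \<Longrightarrow> B i j = (\<Sum>k<n. M i k * M j k)"
    by blast
  define L where "L i k = (case k of 0 \<Rightarrow> A i 0 / sqrt a
      | Suc k' \<Rightarrow> (case i of 0 \<Rightarrow> 0 | Suc i' \<Rightarrow> M i' k'))" for i k
  have "L i k = 0" if "i < Suc n" "k < Suc n" "i < k" for i k
    using that M(1) by (auto simp: L_def split: nat.splits)
  moreover have "0 < L i i" if "i < Suc n" for i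
    using that M(2) a by (auto simp: L_def a_def split: nat.splits)
  moreover have "A i j = (\<Sum>k<Suc n. L i k * L j k)" if ij: "i < Suc n" "j < Suc n" for i j
  proof -
    have "(\<Sum>k<Suc n. L i k * L j k) = A i 0 * A j 0 / a + (\<Sum>k<n. L i (Suc k) * L j (Suc k))"
      using a by (simp only: sum.lessThan_Suc_shift) (simp add: L_def)
    also have "\<dots> = A i j"
    proof (cases "i = 0 \<or> j = 0")
      case True
      then show ?thesis
        using a sym[OF ij] by (auto simp: L_def a_def)
    next
      case False
      then obtain i' j' where "i = Suc i'" "j = Suc j'" by (meson not0_implies_Suc)
      with ij M(3)[of i' j'] show ?thesis
        using sym[of 0 j] by (simp add: L_def B_def)
    qed
    finally show ?thesis by simp
  qed
  ultimately show ?case by (intro exI[of _ L]) blast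
qed

lemma sym_pos_def_cholesky_root_exists:
  assumes "A \<in> sym_pos_def n"
  shows "\<exists>L. cholesky_root n A L"
proof -
  have A: "A \<in> carrier_mat n n" "A\<^sup>T = A"
    and pd: "\<And>v. v \<in> carrier_vec n \<Longrightarrow> v \<noteq> 0\<^sub>v n \<Longrightarrow> 0 < v \<bullet> (A *\<^sub>v v)"
    using assms by (auto simp: sym_pos_def_def)
  have sym: "A $$ (i, j) = A $$ (j, i)" if "i < n" "j < n" for i j
    using that A by (metis carrier_matD index_transpose_mat(1))
  have pos: "0 < (\<Sum>i<n. \<Sum>j<n. v i * A $$ (i, j) * v j)" if "\<exists>i<n. v i \<noteq> 0" for v :: "nat \<Rightarrow> real"
  proof -
    have "vec n v \<noteq> 0\<^sub>v n"
      using that by (metis index_vec index_zero_vec(1))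
    from pd[OF _ this] show ?thesis
      using A by (simp add: scalar_prod_def lessThan_atLeast0 sum_distrib_left mult.assoc)
  qed
  obtain L where L: "\<forall>i<n. \<forall>k<n. i < k \<longrightarrow> L i k = 0" "\<forall>i<n. 0 < L i i"
    "\<forall>i<n. \<forall>j<n. A $$ (i, j) = (\<Sum>k<n. L i k * L j k)"
    using cholesky_factor_exists[of n "\<lambda>i j. A $$ (i, j)"] sym pos by blast
  have "cholesky_root n A (mat n n (\<lambda>(i, j). L i j))"
    unfolding cholesky_root_def
  proof (intro conjI)
    show "A = mat n n (\<lambda>(i, j). L i j) * (mat n n (\<lambda>(i, j). L i j))\<^sup>T"
      using A L(3) by (intro eq_matI) (auto simp: scalar_prod_def lessThan_atLeast0)
  qed (use L(1,2) in \<open>auto simp: lower_triangular_def\<close>)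
  then show ?thesis by blast
qed

text \<open>The quadratic form at \<open>v\<close> is the squared norm of \<open>L\<^sup>T *\<^sub>v v\<close>, and \<open>L\<^sup>T\<close> is injective.\<close>

lemma gram_sym_pos_def:
  assumes L: "L \<in> carrier_mat n n" and "det L \<noteq> 0"
  shows "L * L\<^sup>T \<in> sym_pos_def n"
  unfolding sym_pos_def_def
proof (intro CollectI conjI ballI impI)
  show "L * L\<^sup>T \<in> carrier_mat n n" "(L * L\<^sup>T)\<^sup>T = L * L\<^sup>T"
    using L by (auto simp: transpose_mult[of _ n n])
  fix v :: "real vec"
  assume v: "v \<in> carrier_vec n" "v \<noteq> 0\<^sub>v n"
  define w where "w = L\<^sup>T *\<^sub>v v"
  have w: "w \<in> carrier_vec n" using L v by (simp add: w_def)
  have "w \<noteq> 0\<^sub>v n"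
    using det_0_iff_vec_prod_zero[of "L\<^sup>T" n] L v assms(2) det_transpose[OF L] by (auto simp: w_def)
  then obtain i where i: "i < n" "w $ i \<noteq> 0"
    using w by (metis carrier_vecD eq_vecI index_zero_vec)
  have "v \<bullet> ((L * L\<^sup>T) *\<^sub>v v) = w \<bullet> w"
    using L v w transpose_vec_mult_scalar[of L n n w v] by (simp add: w_def)
  also have "\<dots> > 0"
    unfolding scalar_prod_def
    by (rule sum_pos2[where i=i]) (use w i in \<open>auto simp: zero_less_mult_iff\<close>)
  finally show "0 < v \<bullet> ((L * L\<^sup>T) *\<^sub>v v)" .
qed

lemma holq_space_lower_triangular:
  assumes "L \<in> holq_space p J k"
  shows "L \<in> carrier_mat (p k) (p k)" "lower_triangular L" "det L = 1"
proof -
  have *: "L \<in> carrier_mat (p k) (p k) \<and> lower_triangular L \<and> det L = 1"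
    using assms det_lower_triangular_prod[of L "p k"]
    by (auto simp: holq_space_def G_plus_def G_Ch_def D_plus_def sym_pos_def_def diagonal_mat_def
        lower_triangular_def split: if_splits)
  then show "L \<in> carrier_mat (p k) (p k)" "lower_triangular L" "det L = 1" by auto
qed

lemma diagonal_gram:
  fixes L :: "real mat"
  assumes L: "L \<in> carrier_mat n n" "diagonal_mat L"
  shows "diagonal_mat (L * L\<^sup>T)"
proof -
  have "L $$ (i, x) * L $$ (j, x) = 0" if "i < n" "j < n" "x < n" "i \<noteq> j" for i j x
    using L that by (cases "i = x") (auto simp: diagonal_mat_def)
  then show ?thesis
    using L(1) unfolding diagonal_mat_def by (auto simp: scalar_prod_def intro!: sum.neutral)
qed

text \<open>This lemma and its converse below say that \<open>L \<mapsto> L * L\<^sup>T\<close> maps the factors over which a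
  HOLQ junior minimizes onto the covariance matrices of the model, mode by mode.\<close>

lemma gram_in_cov_space:
  assumes "L \<in> holq_space p J k"
  shows "L * L\<^sup>T \<in> cov_space p J k"
proof -
  note L = holq_space_lower_triangular[OF assms]
  have "det (L * L\<^sup>T) = 1"
    using L by (simp add: det_mult[of _ "p k"] det_transpose)
  moreover have "L * L\<^sup>T \<in> sym_pos_def (p k)"
    using gram_sym_pos_def L by simp
  ultimately show ?thesis
    using assms L diagonal_gram[of L "p k"]
    by (auto simp: holq_space_def cov_space_def S_one_def D_plus_def S_Ch_def cholesky_root_def G_Ch_def
        split: if_splits)
qed

definition diag_of :: "nat \<Rightarrow> (nat \<Rightarrow> real) \<Rightarrow> real mat" where
  "diag_of n d = mat n n (\<lambda>(i, j). if i = j then d i else 0)"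

lemma diag_of_gram:
  assumes "\<And>i. i < n \<Longrightarrow> 0 \<le> d i"
  shows "diag_of n (\<lambda>i. sqrt (d i)) * (diag_of n (\<lambda>i. sqrt (d i)))\<^sup>T = diag_of n d"
  using assms
  by (intro eq_matI) (auto simp: diag_of_def scalar_prod_def if_distrib[of "\<lambda>x. _ * x"] cong: if_cong)

lemma det_diag_of: "det (diag_of n d) = (\<Prod>i<n. d i)"
  by (subst det_lower_triangular_prod[of _ n]) (auto simp: diag_of_def lower_triangular_def)

text \<open>A positive diagonal matrix is the Gram matrix of its entrywise root.\<close>

lemma diag_of_sym_pos_def:
  assumes "\<And>i. i < n \<Longrightarrow> 0 < d i"
  shows "diag_of n d \<in> sym_pos_def n"
proof -
  have "sqrt (d i) \<noteq> 0" if "i < n" for i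
    using assms[OF that] by simp
  then have "det (diag_of n (\<lambda>i. sqrt (d i))) \<noteq> 0"
    unfolding det_diag_of by (subst prod_zero_iff) auto
  moreover have "diag_of n (\<lambda>i. sqrt (d i)) \<in> carrier_mat n n"
    by (simp add: diag_of_def)
  ultimately show ?thesis
    using gram_sym_pos_def diag_of_gram[of n d] assms by (metis less_imp_le)
qed

lemma sym_pos_def_diag_pos:
  assumes "A \<in> sym_pos_def n" "i < n"
  shows "0 < A $$ (i, i)"
proof -
  have "0 < unit_vec n i \<bullet> (A *\<^sub>v unit_vec n i)"
    using assms unfolding sym_pos_def_def
    by (metis (mono_tags, lifting) mem_Collect_eq unit_vec_carrier unit_vec_nonzero)
  moreover have "A \<in> carrier_mat n n"
    using assms by (simp add: sym_pos_def_def)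
  ultimately show ?thesis
    using assms(2) by (simp add: scalar_prod_left_unit[of _ n])
qed

text \<open>The factor is the Cholesky root, except for diagonal matrices, where the explicit entrywise root
  is visibly diagonal. Positivity of the diagonal selects the root \<open>1\<close> of \<open>(det L)\<^sup>2 = 1\<close>.\<close>

lemma cov_space_gram:
  assumes S: "S \<in> cov_space p J k"
  shows "\<exists>L \<in> holq_space p J k. S = L * L\<^sup>T"
proof -
  let ?n = "p k"
  have det_root: "det L = 1" if "L \<in> carrier_mat ?n ?n" "0 < det L" "det (L * L\<^sup>T) = 1" for L :: "real mat"
  proof -
    have "(det L)\<^sup>2 = 1"
      using that by (simp add: det_mult[of _ ?n] det_transpose power2_eq_square)
    then show ?thesis using that by (auto simp: power2_eq_1_iff)
  qed
  have one: "1\<^sub>m ?n = 1\<^sub>m ?n * (1\<^sub>m ?n :: real mat)\<^sup>T"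
    by (simp add: right_mult_one_mat[of _ ?n ?n])
  consider "k \<in> J 1" | "k \<notin> J 1" "k \<in> J 2" | "k \<notin> J 1" "k \<notin> J 2" "k \<in> J 3"
    | "k \<notin> J 1" "k \<notin> J 2" "k \<notin> J 3" by blast
  then show ?thesis
  proof cases
    case 1
    then have "S \<in> sym_pos_def ?n" and det: "det S = 1"
      using S by (auto simp: cov_space_def S_one_def)
    then obtain L where L: "cholesky_root ?n S L"
      using sym_pos_def_cholesky_root_exists by blast
    then have "0 < det L"
      by (auto simp: cholesky_root_def det_lower_triangular_prod intro!: prod_pos)
    with L det have "L \<in> G_plus ?n"
      using det_root by (auto simp: cholesky_root_def G_plus_def)
    then show ?thesis
      using 1 L by (auto simp: holq_space_def cholesky_root_def)
  next
    case 2
    then have spd: "S \<in> sym_pos_def ?n" and "diagonal_mat S" and det: "det S = 1"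
      using S by (auto simp: cov_space_def D_plus_def)
    then have S_eq: "S = diag_of ?n (\<lambda>i. S $$ (i, i))"
      by (intro eq_matI) (auto simp: diag_of_def diagonal_mat_def sym_pos_def_def)
    define L where "L = diag_of ?n (\<lambda>i. sqrt (S $$ (i, i)))"
    have pos: "0 < S $$ (i, i)" if "i < ?n" for i
      using sym_pos_def_diag_pos spd that by blast
    then have gram: "S = L * L\<^sup>T"
      unfolding L_def by (subst S_eq, subst diag_of_gram) (auto intro: less_imp_le)
    have "0 < det L"
      using pos by (auto simp: L_def det_diag_of intro!: prod_pos)
    moreover have "L \<in> carrier_mat ?n ?n"
      by (simp add: L_def diag_of_def)
    moreover have "det (L * L\<^sup>T) = 1"
      unfolding gram[symmetric] by (rule det)
    ultimately have "det L = 1"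
      using det_root by blast
    moreover have "L \<in> sym_pos_def ?n"
      unfolding L_def using pos by (intro diag_of_sym_pos_def) auto
    moreover have "diagonal_mat L"
      by (auto simp: L_def diag_of_def diagonal_mat_def)
    ultimately have "L \<in> holq_space p J k"
      using 2 by (simp add: holq_space_def D_plus_def)
    with gram show ?thesis by blast
  next
    case 3
    then show ?thesis
      using S by (auto simp: cov_space_def holq_space_def S_Ch_def G_Ch_def cholesky_root_def)
  next
    case 4
    then show ?thesis
      using S one by (auto simp: cov_space_def holq_space_def)
  qed
qed

section \<open>The likelihood in terms of Cholesky factors\<close>

lemma inv_mat:
  assumes A: "A \<in> carrier_mat n n" and "det A \<noteq> 0"
  shows "inv_mat A \<in> carrier_mat n n" "A * inv_mat A = 1\<^sub>m n" "inv_mat A * A = 1\<^sub>m n"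
proof -
  obtain B where B: "mat_inverse A = Some B"
    using mat_inverse(1)[OF A, of "()"] det_non_zero_imp_unit[OF assms, of "()"] by (cases "mat_inverse A") auto
  with mat_inverse(2)[OF A B] show "inv_mat A \<in> carrier_mat n n" "A * inv_mat A = 1\<^sub>m n" "inv_mat A * A = 1\<^sub>m n"
    by (auto simp: inv_mat_def)
qed

lemma inv_mat_eqI:
  assumes A: "A \<in> carrier_mat n n" and B: "B \<in> carrier_mat n n" and AB: "A * B = 1\<^sub>m n"
  shows "inv_mat A = B"
proof -
  have "det A * det B = 1"
    using det_mult[OF A B] AB by simp
  then have I: "inv_mat A \<in> carrier_mat n n" "inv_mat A * A = 1\<^sub>m n"
    using inv_mat[OF A] by force+
  have "inv_mat A = inv_mat A * (A * B)"
    using I AB by simp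
  also have "\<dots> = (inv_mat A * A) * B"
    using I A B by (subst assoc_mult_mat) auto
  finally show ?thesis
    using I B by simp
qed

lemma smult_mat_mult_vec:
  fixes A :: "real mat"
  assumes "A \<in> carrier_mat m n" "v \<in> carrier_vec n"
  shows "(c \<cdot>\<^sub>m A) *\<^sub>v v = c \<cdot>\<^sub>v (A *\<^sub>v v)"
  using assms by (intro eq_vecI) (auto simp: scalar_prod_def sum_distrib_left mult.assoc)

text \<open>With \<open>N\<close> the Kronecker product of the \<open>M k\<close>, the covariance matrix is \<open>s \<cdot>\<^sub>m (N * N\<^sup>T)\<close>. Its
  determinant is \<open>s ^ total_dim K p\<close> because \<open>det N = 1\<close>, and its quadratic form is \<open>1 / s\<close> times
  the squared norm of \<open>W *\<^sub>v vectorize K p X\<close> for the inverse \<open>W\<close> of \<open>N\<close>. As \<open>W\<close> is the Kronecker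
  product of the inverses, that vector is the vectorized HOLQ residual.\<close>

lemma likelihood_gram:
  assumes "0 < s"
    and S: "\<And>k. k \<in> {1..K} \<Longrightarrow> S k = M k * (M k)\<^sup>T"
    and M: "\<And>k. k \<in> {1..K} \<Longrightarrow> M k \<in> carrier_mat (p k) (p k)"
    and low: "\<And>k. k \<in> {1..K} \<Longrightarrow> lower_triangular (M k)"
    and det: "\<And>k. k \<in> {1..K} \<Longrightarrow> det (M k) = 1"
  shows "likelihood K p X (s, S) = (2 * pi * s) powr (- (real (total_dim K p) / 2)) *
    exp (- (frob_norm K p (holq_residual K p X M))\<^sup>2 / (2 * s))"
proof -
  let ?P = "total_dim K p" and ?x = "vectorize K p X"
  define N where "N = kron_prod M K"
  define W where "W = kron_prod (\<lambda>k. inv_mat (M k)) K"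
  have inv: "inv_mat (M k) \<in> carrier_mat (p k) (p k)" "inv_mat (M k) * M k = 1\<^sub>m (p k)"
    "M k * inv_mat (M k) = 1\<^sub>m (p k)" if "k \<in> {1..K}" for k
    using inv_mat[OF M[OF that]] det[OF that] by auto
  have MT: "(M k)\<^sup>T \<in> carrier_mat (p k) (p k)" if "k \<in> {1..K}" for k
    using M[OF that] by simp
  have N: "N \<in> carrier_mat ?P ?P" and W: "W \<in> carrier_mat ?P ?P"
    unfolding N_def W_def
    by (rule kron_prod_carrier, erule M, rule kron_prod_carrier, erule inv(1))
  have x: "?x \<in> carrier_vec ?P" by (simp add: vectorize_def)
  have "kron_prod S K = kron_prod (\<lambda>k. M k * (M k)\<^sup>T) K"
    using S by (rule kron_prod_cong)
  also have "\<dots> = N * N\<^sup>T"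
    unfolding N_def using kron_prod_mult[of K M p, OF M MT] by (simp add: kron_prod_transpose)
  finally have SN: "kron_prod S K = N * N\<^sup>T" .
  have WN: "W * N = 1\<^sub>m ?P"
    using kron_prod_mult[of K "\<lambda>k. inv_mat (M k)" p M, OF inv(1) M] kron_prod_one[of p K]
      kron_prod_cong[of K "\<lambda>k. inv_mat (M k) * M k" "\<lambda>k. 1\<^sub>m (p k)", OF inv(2)]
    unfolding N_def W_def by simp
  have NW: "N * W = 1\<^sub>m ?P"
    using kron_prod_mult[of K M p "\<lambda>k. inv_mat (M k)", OF M inv(1)] kron_prod_one[of p K]
      kron_prod_cong[of K "\<lambda>k. M k * inv_mat (M k)" "\<lambda>k. 1\<^sub>m (p k)", OF inv(3)]
    unfolding N_def W_def by simp
  have "det N = 1"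
    unfolding N_def using kron_prod_unit_det[of K M p] M low det by blast
  then have detC: "det (s \<cdot>\<^sub>m (N * N\<^sup>T)) = s ^ ?P"
    using N by (simp add: det_mult[of _ ?P] det_transpose)
  have "N * N\<^sup>T * (W\<^sup>T * W) = N * (N\<^sup>T * W\<^sup>T) * W"
    using N W by (simp add: assoc_mult_mat[of _ ?P ?P _ ?P _ ?P])
  also have "N\<^sup>T * W\<^sup>T = 1\<^sub>m ?P"
    using transpose_mult[OF W N] WN by simp
  finally have gram_inv: "N * N\<^sup>T * (W\<^sup>T * W) = 1\<^sub>m ?P"
    using N NW by simp
  have invC: "inv_mat (s \<cdot>\<^sub>m (N * N\<^sup>T)) = (1 / s) \<cdot>\<^sub>m (W\<^sup>T * W)"
  proof (rule inv_mat_eqI)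
    have "(s \<cdot>\<^sub>m (N * N\<^sup>T)) * ((1 / s) \<cdot>\<^sub>m (W\<^sup>T * W)) = s \<cdot>\<^sub>m ((1 / s) \<cdot>\<^sub>m (N * N\<^sup>T * (W\<^sup>T * W)))"
      using N W by (subst mult_smult_assoc_mat[of _ ?P ?P _ ?P])
        (auto simp: mult_smult_distrib[of "N * N\<^sup>T" ?P ?P "W\<^sup>T * W" ?P] simp del: assoc_mult_mat)
    then show "(s \<cdot>\<^sub>m (N * N\<^sup>T)) * ((1 / s) \<cdot>\<^sub>m (W\<^sup>T * W)) = 1\<^sub>m ?P"
      using \<open>0 < s\<close> by (auto simp: gram_inv)
  qed (use N W in auto)
  define w where "w = W *\<^sub>v ?x"
  have w: "w \<in> carrier_vec ?P" using W x by (simp add: w_def)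
  have "((1 / s) \<cdot>\<^sub>m (W\<^sup>T * W)) *\<^sub>v ?x = (1 / s) \<cdot>\<^sub>v (W\<^sup>T *\<^sub>v w)"
    using W x by (simp add: w_def smult_mat_mult_vec[of _ ?P ?P])
  then have "?x \<bullet> (((1 / s) \<cdot>\<^sub>m (W\<^sup>T * W)) *\<^sub>v ?x) = (1 / s) * (?x \<bullet> (W\<^sup>T *\<^sub>v w))"
    using W x w by simp
  also have "?x \<bullet> (W\<^sup>T *\<^sub>v w) = (W\<^sup>T *\<^sub>v w) \<bullet> ?x"
    using W x w by (intro comm_scalar_prod[of _ ?P]) auto
  also have "\<dots> = w \<bullet> w"
    using transpose_vec_mult_scalar[OF W x w] by (simp add: w_def)
  also have "\<dots> = (frob_norm K p (holq_residual K p X M))\<^sup>2"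
    unfolding w_def W_def holq_residual_def
    by (simp only: kron_prod_mult_vectorize[OF inv(1)] vectorize_sq_norm)
  finally have quad: "?x \<bullet> (inv_mat (s \<cdot>\<^sub>m (N * N\<^sup>T)) *\<^sub>v ?x)
      = (frob_norm K p (holq_residual K p X M))\<^sup>2 / s"
    by (simp add: invC)
  have "(s ^ ?P) powr (- (1 / 2)) = s powr (- (real ?P / 2))"
    using \<open>0 < s\<close> by (simp add: powr_realpow[symmetric] powr_powr)
  then show ?thesis
    using \<open>0 < s\<close> x
    unfolding likelihood_def normal_density_vec_def prod.case SN detC quad
    by (simp add: powr_mult vectorize_def mult.commute)
qed

text \<open>With \<open>u = l\<^sup>2 / (P * s)\<close> and \<open>r = l\<close>, the logarithm of \<open>f / m\<close> is \<open>P / 2 * (ln u + 1 - u)\<close>, so the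
  bound is \<open>ln u \<le> u - 1\<close>, with equality only for \<open>u = 1\<close>. A larger \<open>r\<close> only decreases \<open>f\<close>.\<close>

lemma gaussian_scale_bound:
  fixes P l r s :: real
  assumes "0 < P" "0 < l" "l \<le> r" "0 < s"
  defines "f \<equiv> (2 * pi * s) powr (- (P / 2)) * exp (- r\<^sup>2 / (2 * s))"
    and "m \<equiv> (2 * pi * (l\<^sup>2 / P)) powr (- (P / 2)) * exp (- (P / 2))"
  shows "f \<le> m" and "f = m \<Longrightarrow> s = l\<^sup>2 / P"
proof -
  define u where "u = l\<^sup>2 / P / s"
  have u: "0 < u" using assms by (simp add: u_def)
  have s: "2 * pi * (l\<^sup>2 / P) = 2 * pi * s * u"
    using assms by (simp add: u_def)
  have "l\<^sup>2 \<le> r\<^sup>2" using assms by (intro power_mono) auto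
  then have r: "P / 2 * u \<le> r\<^sup>2 / (2 * s)"
    using assms by (simp add: u_def divide_right_mono)
  have f: "f = exp (- (P / 2) * ln (2 * pi * s) - r\<^sup>2 / (2 * s))"
    using assms by (simp add: f_def powr_def mult_exp_exp)
  have m: "m = exp (- (P / 2) * ln (2 * pi * s) - P / 2 * (ln u + 1))"
    unfolding m_def s using u \<open>0 < s\<close>
    by (simp add: powr_def ln_mult exp_add[symmetric] algebra_simps)
  have ln: "ln u \<le> u - 1" by (rule ln_le_minus_one[OF u])
  then have "P / 2 * (ln u + 1) \<le> P / 2 * u"
    using assms by (intro mult_left_mono) auto
  then show "f \<le> m"
    unfolding f m using r by simp
  assume "f = m"
  then have "P / 2 * (ln u + 1) = r\<^sup>2 / (2 * s)"
    unfolding f m by simp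
  with r have "P / 2 * u \<le> P / 2 * (ln u + 1)" by simp
  then have "u \<le> ln u + 1"
    using \<open>0 < P\<close> by simp
  then have "u = 1"
    using ln u by (intro ln_eq_minus_one) auto
  then show "s = l\<^sup>2 / P"
    using \<open>0 < s\<close> \<open>0 < P\<close> by (simp add: u_def field_simps)
qed

section \<open>Maximum likelihood estimation\<close>

theorem theorem6:
  fixes K :: nat and p :: "nat \<Rightarrow> nat" and J :: "nat \<Rightarrow> nat set"
    and X Q :: "(nat \<Rightarrow> nat) \<Rightarrow> real" and l :: real and L :: "nat \<Rightarrow> real mat"
  assumes "X \<in> arrays K p"
    and "disjoint_family_on J {1..4}" and "(\<Union>i\<in>{1..4}. J i) = {1..K}"
    and "holq_junior K p J X l L Q"
  shows "let P = real (total_dim K p); s_hat = l\<^sup>2 / P in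
    is_MLE K p J X s_hat (\<lambda>k. L k * (L k)\<^sup>T) \<and>
    (\<forall>s S. is_MLE K p J X s S \<longrightarrow> s = s_hat) \<and>
    (GREATEST y. y \<in> likelihood K p X ` param_space K p J)
      = (2 * pi * s_hat) powr (- (P / 2)) * exp (- (P / 2)) \<and>
    (2 * pi * s_hat) powr (- (P / 2)) * exp (- (P / 2))
      = (2 * pi * l\<^sup>2 / P) powr (- (P / 2)) * exp (- (P / 2))"
proof -
  define P where "P = real (total_dim K p)"
  define s_hat where "s_hat = l\<^sup>2 / P"
  define m where "m = (2 * pi * s_hat) powr (- (P / 2)) * exp (- (P / 2))"
  define r where "r M = frob_norm K p (holq_residual K p X M)" for M
  have min: "is_arg_min r (\<lambda>M. M \<in> (\<Pi> k\<in>{1..K}. holq_space p J k)) L" and l: "l = r L" "0 < l"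
    using assms(4) unfolding holq_junior_def r_def by blast+
  have L: "L k \<in> holq_space p J k" if "k \<in> {1..K}" for k
    using min that unfolding is_arg_min_def by blast
  have r_min: "l \<le> r M" if "\<And>k. k \<in> {1..K} \<Longrightarrow> M k \<in> holq_space p J k" for M
  proof -
    have "M \<in> (\<Pi> k\<in>{1..K}. holq_space p J k)" using that by (rule Pi_I)
    with min have "\<not> r M < r L" unfolding is_arg_min_def by blast
    then show ?thesis unfolding l(1) by simp
  qed
  \<comment> \<open>An array without entries has residual norm zero, so \<open>0 < l\<close> excludes it.\<close>
  have "total_dim K p \<noteq> 0"
  proof
    assume "total_dim K p = 0"
    then have "(r L)\<^sup>2 = 0"
      unfolding r_def vectorize_sq_norm[symmetric] by (simp add: vectorize_def scalar_prod_def)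
    with l show False by simp
  qed
  then have P: "0 < P" by (simp add: P_def)
  then have s_hat: "0 < s_hat" using l by (simp add: s_hat_def)
  have lik: "likelihood K p X (s, S) = (2 * pi * s) powr (- (P / 2)) * exp (- (r M)\<^sup>2 / (2 * s))"
    if "0 < s" "\<And>k. k \<in> {1..K} \<Longrightarrow> M k \<in> holq_space p J k" "\<And>k. k \<in> {1..K} \<Longrightarrow> S k = M k * (M k)\<^sup>T"
    for s S M
    unfolding P_def r_def using that(1,3)
    by (rule likelihood_gram) (use holq_space_lower_triangular that(2) in blast)+
  have bound: "likelihood K p X (s, S) \<le> m \<and> (likelihood K p X (s, S) = m \<longrightarrow> s = s_hat)"
    if "(s, S) \<in> param_space K p J" for s S
  proof -
    have s: "0 < s" and S: "\<And>k. k \<in> {1..K} \<Longrightarrow> S k \<in> cov_space p J k"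
      using that by (auto simp: param_space_def)
    have "\<forall>k\<in>{1..K}. \<exists>M. M \<in> holq_space p J k \<and> S k = M * M\<^sup>T"
      using cov_space_gram S by blast
    then obtain M where M: "\<And>k. k \<in> {1..K} \<Longrightarrow> M k \<in> holq_space p J k"
      "\<And>k. k \<in> {1..K} \<Longrightarrow> S k = M k * (M k)\<^sup>T"
      by metis
    have "l \<le> r M" by (rule r_min) (rule M(1))
    from gaussian_scale_bound[OF P l(2) this s] show ?thesis
      using lik[OF s M] by (simp add: m_def s_hat_def)
  qed
  let ?S = "\<lambda>k. L k * (L k)\<^sup>T"
  have hat: "(s_hat, ?S) \<in> param_space K p J"
    using s_hat L gram_in_cov_space by (auto simp: param_space_def)
  have "l\<^sup>2 / (2 * s_hat) = P / 2"
    using l P by (simp add: s_hat_def)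
  then have at_hat: "likelihood K p X (s_hat, ?S) = m"
    using lik[OF s_hat L refl] unfolding l(1)[symmetric] by (simp add: m_def)
  have mle: "is_MLE K p J X s_hat ?S"
    unfolding is_MLE_def is_arg_max_def at_hat
    using hat bound by (metis not_less surj_pair)
  have unique: "s = s_hat" if "is_MLE K p J X s S" for s S
  proof -
    have "(s, S) \<in> param_space K p J" "\<not> likelihood K p X (s, S) < likelihood K p X (s_hat, ?S)"
      using that hat unfolding is_MLE_def is_arg_max_def by blast+
    then show ?thesis
      using bound[of s S] unfolding at_hat by auto
  qed
  have max: "(GREATEST y. y \<in> likelihood K p X ` param_space K p J) = m"
  proof (rule Greatest_equality)
    show "m \<in> likelihood K p X ` param_space K p J"
      using hat at_hat by (rule rev_image_eqI[OF _ sym])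
    show "y \<le> m" if "y \<in> likelihood K p X ` param_space K p J" for y
      using that bound by (metis imageE surj_pair)
  qed
  have "2 * pi * s_hat = 2 * pi * l\<^sup>2 / P"
    by (simp add: s_hat_def)
  then have "m = (2 * pi * l\<^sup>2 / P) powr (- (P / 2)) * exp (- (P / 2))"
    by (simp only: m_def)
  then show ?thesis
    unfolding Let_def P_def[symmetric] s_hat_def[symmetric] m_def[symmetric]
    using mle unique max by blast
qed

end
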